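(* Let $\mathcal{H}$ be a nonzero complex Hilbert space, $B\in\mathcal{B}(\mathcal{H})$, and let $A\in\mathcal{M}_n(\mathbb{C})$ have non-negative real entries and be equal to $k$ times a doubly stochastic matrix for some $k\in[0,\infty)$. Then for every $1\le p\le\infty$, $$\|A\otimes B\|_p=k\|B\|\qquad\text{and}\qquad w(A\otimes B)=k\,w(B).$$
   Context: A doubly stochastic matrix is a square matrix with non-negative real entries all of whose row sums and column sums equal $1$. $\mathcal{B}(\mathcal{H})$ denotes the bounded linear operators on $\mathcal{H}$ and $\|\cdot\|$ the operator norm. The numerical radius of a bounded operator $T$ on a complex Hilbert space $\mathcal{K}$ is $w(T)=\sup\{|\langle Tx,x\rangle| : x\in\mathcal{K},\ \|x\|=1\}$. The Kronecker product $A\otimes B=[a_{ij}B]_{i,j=1}^n$ is the operator matrix acting on $\mathcal{H}^n=\mathcal{H}^{\oplus n}$. For $1\le p\le\infty$, $$\|A\otimes B\|_p=\sup\left\{\frac{\|(A\otimes B)x\|_p}{\|x\|_p} : x\in\mathcal{H}^n,\ x\ne 0\right\},$$ where $\|x\|_p=\left(\sum_{j=1}^n\|x_j\|^p\right)^{1/p}$ for $x=(x_1,\dots,x_n)^T\in\mathcal{H}^n$ (and $\|x\|_\infty=\max_j\|x_j\|$). *)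

theory Defs
  imports "HOL-Analysis.Analysis"
begin

class complex_vector = real_vector +
  fixes scaleC :: "complex \<Rightarrow> 'a \<Rightarrow> 'a" (infixr "*\<^sub>C" 75)
  assumes scaleC_add_right: "c *\<^sub>C (x + y) = c *\<^sub>C x + c *\<^sub>C y"
    and scaleC_add_left: "(c + d) *\<^sub>C x = c *\<^sub>C x + d *\<^sub>C x"
    and scaleC_scaleC: "c *\<^sub>C d *\<^sub>C x = (c * d) *\<^sub>C x"
    and scaleR_scaleC: "r *\<^sub>R x = complex_of_real r *\<^sub>C x"

text \<open>The inner product is linear in the first argument. The last axiom says that the norm is the
  one induced by the inner product; it also yields positive definiteness.\<close>

class complex_inner = complex_vector + real_normed_vector +
  fixes cinner :: "'a \<Rightarrow> 'a \<Rightarrow> complex"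
  assumes cinner_commute: "cinner x y = cnj (cinner y x)"
    and cinner_add_left: "cinner (x + y) z = cinner x z + cinner y z"
    and cinner_scaleC_left: "cinner (c *\<^sub>C x) y = c * cinner x y"
    and cinner_self: "cinner x x = complex_of_real ((norm x)\<^sup>2)"

class complex_hilbert_space = complex_inner + complete_space

instantiation complex :: complex_hilbert_space
begin

definition scaleC_complex :: "complex \<Rightarrow> complex \<Rightarrow> complex"
  where "scaleC_complex c x = c * x"

definition cinner_complex :: "complex \<Rightarrow> complex \<Rightarrow> complex"
  where "cinner_complex x y = x * cnj y"

instance
  by standard
    (simp_all add: scaleC_complex_def cinner_complex_def algebra_simps scaleR_conv_of_real
      complex_norm_square del: of_real_power)

end

text \<open>The Hilbert direct sum of \<open>CARD('n)\<close> copies of a Hilbert space. The library's norm on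
  \<^typ>\<open>'a ^ 'n\<close> is already the Euclidean combination of the component norms.\<close>

instantiation vec :: (complex_vector, finite) complex_vector
begin

definition scaleC_vec :: "complex \<Rightarrow> 'a ^ 'b \<Rightarrow> 'a ^ 'b"
  where "scaleC_vec c x = (\<chi> i. c *\<^sub>C x $ i)"

instance
  by standard
    (simp_all add: scaleC_vec_def vec_eq_iff scaleC_add_right scaleC_add_left scaleC_scaleC
      scaleR_scaleC)

end

instantiation vec :: (complex_inner, finite) complex_inner
begin

definition cinner_vec :: "'a ^ 'b \<Rightarrow> 'a ^ 'b \<Rightarrow> complex"
  where "cinner_vec x y = (\<Sum>i\<in>UNIV. cinner (x $ i) (y $ i))"

instance
proof
  fix x y z :: "'a ^ 'b" and c :: complex
  show "cinner x y = cnj (cinner y x)"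
    unfolding cinner_vec_def cnj_sum by (intro sum.cong refl cinner_commute)
  show "cinner (x + y) z = cinner x z + cinner y z"
    by (simp add: cinner_vec_def cinner_add_left sum.distrib)
  show "cinner (c *\<^sub>C x) y = c * cinner x y"
    by (simp add: cinner_vec_def scaleC_vec_def cinner_scaleC_left sum_distrib_left)
  show "cinner x x = complex_of_real ((norm x)\<^sup>2)"
    by (simp add: cinner_vec_def cinner_self norm_vec_def L2_set_def sum_nonneg
        del: of_real_power)
qed

end

instance vec :: (complex_hilbert_space, finite) complex_hilbert_space ..

definition bounded_clinear :: "('a::complex_inner \<Rightarrow> 'b::complex_inner) \<Rightarrow> bool"
  where "bounded_clinear T \<longleftrightarrow> bounded_linear T \<and> (\<forall>c x. T (c *\<^sub>C x) = c *\<^sub>C T x)"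

text \<open>The suprema below are taken in \<^typ>\<open>real\<close>, so \<open>numerical_radius\<close> and \<open>op_lp_norm\<close> are
  meaningful for bounded operators on nonzero spaces only.\<close>

definition numerical_radius :: "('a::complex_inner \<Rightarrow> 'a) \<Rightarrow> real"
  where "numerical_radius T = (SUP x\<in>{x. norm x = 1}. cmod (cinner (T x) x))"

definition doubly_stochastic :: "complex ^ 'n ^ 'n \<Rightarrow> bool"
  where "doubly_stochastic S \<longleftrightarrow>
    (\<forall>i j. S $ i $ j \<in> \<real>\<^sub>\<ge>\<^sub>0) \<and>
    (\<forall>i. (\<Sum>j\<in>UNIV. S $ i $ j) = 1) \<and>
    (\<forall>j. (\<Sum>i\<in>UNIV. S $ i $ j) = 1)"

text \<open>The operator matrix with entries \<open>A $ i $ j\<close> times \<open>B\<close>, acting on column vectors.\<close>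

definition kronecker ::
    "complex ^ 'n ^ 'n \<Rightarrow> ('a::complex_inner \<Rightarrow> 'a) \<Rightarrow> 'a ^ 'n \<Rightarrow> 'a ^ 'n" (infixl "\<otimes>\<^sub>K" 70)
  where "(A \<otimes>\<^sub>K B) x = (\<chi> i. \<Sum>j\<in>UNIV. A $ i $ j *\<^sub>C B (x $ j))"

definition lp_norm :: "ereal \<Rightarrow> ('a::real_normed_vector) ^ 'n \<Rightarrow> real"
  where "lp_norm p x =
    (if p = \<infinity> then Max (range (\<lambda>j. norm (x $ j)))
     else (\<Sum>j\<in>UNIV. norm (x $ j) powr real_of_ereal p) powr (1 / real_of_ereal p))"

definition op_lp_norm ::
    "ereal \<Rightarrow> (('a::real_normed_vector) ^ 'n \<Rightarrow> 'a ^ 'n) \<Rightarrow> real"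
  where "op_lp_norm p T = (SUP x\<in>{x. x \<noteq> 0}. lp_norm p (T x) / lp_norm p x)"

end

theory Submission imports Defs begin

text \<open>Write \<open>A = k S\<close> with \<open>S\<close> doubly stochastic. On a constant vector \<open>(v, \<dots>, v)\<close> the operator
  matrix acts as \<open>k B\<close> on each entry, which gives \<open>\<ge>\<close> in both equations.

  For the operator norms, the entry norms of the image are at most \<open>k \<parallel>B\<parallel>\<close> times the \<open>S\<close>-averages
  of the entry norms of the argument, and averaging with a doubly stochastic matrix does not
  increase an \<open>\<ell>\<^sup>p\<close> norm, by convexity of \<open>t \<mapsto> t^p\<close> (\<open>sum_powr_doubly_stochastic_le\<close>).

  The upper bound for the numerical radius says that
  \<open>\<bar>\<Sum>i j. s\<^sub>i\<^sub>j \<langle>B x\<^sub>j, x\<^sub>i\<rangle>\<bar> \<le> w(B) \<Sum>i. \<parallel>x\<^sub>i\<parallel>\<^sup>2\<close>. It would follow term by term from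
  \<open>2 Re \<langle>B x, y\<rangle> \<le> w(B) (\<parallel>x\<parallel>\<^sup>2 + \<parallel>y\<parallel>\<^sup>2)\<close>, but that inequality is false in general: for a
  nilpotent \<open>B\<close> on a plane, \<open>\<parallel>B\<parallel>\<close> may be \<open>2 w(B)\<close>. It does hold after adding a correction
  \<open>\<phi> x - \<phi> y\<close> on the right (\<open>numerical_range_potential\<close>), and a correction of this form
  disappears when summed against doubly stochastic weights. A potential \<open>\<phi>\<close> exists,
  as a cheapest-path cost, as soon as the uncorrected inequality, summed along a path that starts
  at \<open>0\<close>, fails by at most an amount depending on the end point of the path only. This follows from
  \<open>\<bar>\<Sum>j<N. \<langle>B y\<^sub>j, y\<^sub>j\<^sub>+\<^sub>1\<rangle>\<bar> \<le> w(B) \<Sum>j\<le>N. \<parallel>y\<^sub>j\<parallel>\<^sup>2\<close> (\<open>numerical_range_bound_path\<close>). That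
  inequality is a Fourier averaging of \<open>\<bar>\<langle>B f, f\<rangle>\<bar> \<le> w(B) \<parallel>f\<parallel>\<^sup>2\<close> over the vectors
  \<open>f = \<Sum>j\<le>N. \<zeta>^j y\<^sub>j\<close> with \<open>\<zeta>\<close> a root of unity.\<close>

section \<open>Complex inner product spaces\<close>

lemma cinner_add_right: "cinner x (y + z) = cinner x y + cinner x z"
  by (metis cinner_add_left cinner_commute complex_cnj_add)

lemma cinner_scaleC_right: "cinner x (c *\<^sub>C y) = cnj c * cinner x y"
  by (metis cinner_commute cinner_scaleC_left complex_cnj_mult)

lemma cinner_zero_left [simp]: "cinner 0 y = 0"
  using cinner_add_left [of 0 0 y] by simp

lemma cinner_zero_right [simp]: "cinner x 0 = 0"
  using cinner_add_right [of x 0 0] by simp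

lemma cinner_sum_left: "cinner (\<Sum>i\<in>I. f i) y = (\<Sum>i\<in>I. cinner (f i) y)"
  by (induction I rule: infinite_finite_induct) (simp_all add: cinner_add_left)

lemma cinner_sum_right: "cinner x (\<Sum>i\<in>I. f i) = (\<Sum>i\<in>I. cinner x (f i))"
  by (induction I rule: infinite_finite_induct) (simp_all add: cinner_add_right)

lemma norm_scaleC: "norm (c *\<^sub>C x) = cmod c * norm x"
  for x :: "'a::complex_inner"
proof -
  have "complex_of_real ((norm (c *\<^sub>C x))\<^sup>2) = (c * cnj c) * cinner x x"
    by (simp only: cinner_self [symmetric] cinner_scaleC_left cinner_scaleC_right
        mult.assoc mult.left_commute)
  also have "\<dots> = complex_of_real ((cmod c * norm x)\<^sup>2)"
    by (simp only: complex_norm_square [symmetric] cinner_self power_mult_distrib of_real_mult)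
  finally have "(norm (c *\<^sub>C x))\<^sup>2 = (cmod c * norm x)\<^sup>2"
    using of_real_eq_iff by blast
  then show ?thesis by (simp add: power2_eq_iff_nonneg)
qed

lemma unimodular_rotation_to_norm:
  obtains c :: complex where "cmod c = 1" "Re (c * z) = cmod z"
proof (cases "z = 0")
  case False
  then have "cnj z / cmod z * z = cmod z"
    by (simp add: complex_norm_square [symmetric] mult.commute power2_eq_square)
  with False show ?thesis
    by (intro that [of "cnj z / cmod z"]) (simp_all add: norm_divide)
qed (use that [of 1] in simp)

text \<open>Since the norm is assumed to satisfy the triangle inequality, the Cauchy-Schwarz inequality
  is just the expansion of \<open>\<parallel>x + y\<parallel>\<^sup>2 \<le> (\<parallel>x\<parallel> + \<parallel>y\<parallel>)\<^sup>2\<close>, up to a rotation of \<open>x\<close>.\<close>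

lemma cinner_Cauchy_Schwarz: "cmod (cinner x y) \<le> norm x * norm y"
proof -
  have Re_le: "Re (cinner u v) \<le> norm u * norm v" for u v :: 'a
  proof -
    have sq: "Re (cinner u u) = (norm u)\<^sup>2" for u :: 'a
      by (metis cinner_self Re_complex_of_real)
    have "(norm (u + v))\<^sup>2 = (norm u)\<^sup>2 + (norm v)\<^sup>2 + 2 * Re (cinner u v)"
      using sq [of "u + v"] sq [of u] sq [of v] cinner_commute [of v u]
      by (simp add: cinner_add_left cinner_add_right)
    moreover have "(norm (u + v))\<^sup>2 \<le> (norm u + norm v)\<^sup>2"
      by (intro power_mono norm_triangle_ineq) auto
    ultimately show ?thesis by (simp add: power2_sum)
  qed
  obtain c where "cmod c = 1" "Re (c * cinner x y) = cmod (cinner x y)"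
    by (rule unimodular_rotation_to_norm)
  with Re_le [of "c *\<^sub>C x" y] show ?thesis
    by (simp add: cinner_scaleC_left norm_scaleC)
qed

lemma norm_vec_power2: "(norm x)\<^sup>2 = (\<Sum>i\<in>UNIV. (norm (x $ i))\<^sup>2)"
  by (simp add: norm_vec_def L2_set_def sum_nonneg)

section \<open>Bounded operators\<close>

lemma bounded_clinear_sum:
  assumes "bounded_clinear B"
  shows "B (\<Sum>i\<in>I. f i) = (\<Sum>i\<in>I. B (f i))"
  using assms unfolding bounded_clinear_def by (metis bounded_linear.linear linear_sum)

lemma bounded_clinear_scaleC: "bounded_clinear B \<Longrightarrow> B (c *\<^sub>C x) = c *\<^sub>C B x"
  by (simp add: bounded_clinear_def)

lemma cmod_cinner_le_numerical_radius:
  assumes "bounded_clinear B"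
  shows "cmod (cinner (B x) x) \<le> numerical_radius B * (norm x)\<^sup>2"
proof (cases "x = 0")
  case False
  have bl: "bounded_linear B" using assms by (simp add: bounded_clinear_def)
  have bdd: "bdd_above ((\<lambda>x. cmod (cinner (B x) x)) ` {x. norm x = 1})"
  proof (rule bdd_aboveI2)
    fix x :: 'a assume x: "x \<in> {x. norm x = 1}"
    have "cmod (cinner (B x) x) \<le> norm (B x) * norm x" by (rule cinner_Cauchy_Schwarz)
    with x onorm [OF bl, of x] show "cmod (cinner (B x) x) \<le> onorm B" by simp
  qed
  define r where "r = norm x"
  have r: "r > 0" using False by (simp add: r_def)
  define u where "u = complex_of_real (1 / r) *\<^sub>C x"
  have "norm u = 1" using r by (simp add: u_def norm_scaleC r_def norm_divide)
  then have "cmod (cinner (B u) u) \<le> numerical_radius B"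
    unfolding numerical_radius_def by (intro cSUP_upper bdd) simp
  moreover have "cmod (cinner (B u) u) = cmod (cinner (B x) x) / r\<^sup>2"
    using r by (simp add: u_def bounded_clinear_scaleC [OF assms] cinner_scaleC_left
        cinner_scaleC_right norm_mult norm_divide power2_eq_square)
  ultimately show ?thesis using r by (simp add: divide_le_eq r_def)
qed simp

lemma mult_cSUP_le:
  fixes f :: "'a \<Rightarrow> real"
  assumes "X \<noteq> {}" "0 \<le> k" "0 \<le> c" and le: "\<And>x. x \<in> X \<Longrightarrow> k * f x \<le> c"
  shows "k * (SUP x\<in>X. f x) \<le> c"
proof (cases "k = 0")
  case False
  with assms(2) have "k > 0" by simp
  moreover have "(SUP x\<in>X. f x) \<le> c / k"
    using \<open>k > 0\<close> le by (intro cSUP_least assms(1)) (simp add: le_divide_eq mult.commute)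
  ultimately show ?thesis by (simp add: le_divide_eq mult.commute)
qed (use assms(3) in simp)

section \<open>The numerical radius controls sums along paths\<close>

lemma sum_roots_of_unity_orthogonal:
  assumes "a < M" "b < M"
  shows "(\<Sum>l<M. cis (2 * pi * real l / real M) ^ a * cnj (cis (2 * pi * real l / real M) ^ b))
    = (if a = b then of_nat M else 0)"
proof -
  define w where "w = (\<lambda>k. cis (2 * pi * real k / real M))"
  define g where "g = w a * cnj (w b)"
  have M: "M > 0" using assms by simp
  have unit: "w k * cnj (w k) = 1" for k
    by (simp add: w_def cis_cnj cis_mult)
  have "(\<Sum>l<M. w l ^ a * cnj (w l ^ b)) = (\<Sum>l<M. g ^ l)"
  proof (intro sum.cong refl)
    fix l
    have swap: "w l ^ k = w k ^ l" for k
      unfolding w_def Complex.DeMoivre by (simp add: mult_ac)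
    show "w l ^ a * cnj (w l ^ b) = g ^ l"
      unfolding swap g_def by (simp add: power_mult_distrib)
  qed
  also have "\<dots> = (if a = b then of_nat M else 0)"
  proof (cases "a = b")
    case True
    then show ?thesis by (simp add: g_def unit)
  next
    case False
    have bij: "bij_betw w {..<M} {z. z ^ M = 1}"
      unfolding w_def by (rule Complex.bij_betw_roots_unity [OF M])
    then have pow: "w a ^ M = 1" "w b ^ M = 1"
      using assms by (auto simp: bij_betw_def)
    have "w a \<noteq> w b"
      using bij False assms by (auto simp: bij_betw_def inj_on_def)
    moreover have "g * w b = w a" using unit [of b] by (simp add: g_def mult_ac)
    ultimately have "g \<noteq> 1" by auto
    moreover have "g ^ M = 1"
      using pow by (simp add: g_def power_mult_distrib flip: complex_cnj_power)
    ultimately show ?thesis using False by (simp add: geometric_sum)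
  qed
  finally show ?thesis by (simp add: w_def)
qed

text \<open>A discrete Fourier coefficient: with \<open>f(\<zeta>) = \<Sum>j\<le>N. \<zeta>^j y\<^sub>j\<close>, averaging
  \<open>\<zeta>^d \<langle>B f(\<zeta>), f(\<zeta>)\<rangle>\<close> over the \<open>M\<close>-th roots of unity isolates the \<open>d\<close>-th off-diagonal.
  The bound \<open>N + d < M\<close> prevents indices from wrapping around modulo \<open>M\<close>.\<close>

lemma fourier_coefficient_cinner:
  fixes y :: "nat \<Rightarrow> 'h::complex_inner" and N M d :: nat
  defines "w \<equiv> (\<lambda>l. cis (2 * pi * real l / real M))"
  defines "f \<equiv> (\<lambda>l. \<Sum>j\<le>N. (w l ^ j) *\<^sub>C y j)"
  assumes "bounded_clinear B" and "N + d < M"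
  shows "(\<Sum>l<M. w l ^ d * cinner (B (f l)) (f l))
    = of_nat M * (\<Sum>j\<le>N. \<Sum>k\<le>N. if j + d = k then cinner (B (y j)) (y k) else 0)"
proof -
  have "(\<Sum>l<M. w l ^ d * cinner (B (f l)) (f l))
      = (\<Sum>l<M. \<Sum>j\<le>N. \<Sum>k\<le>N. (w l ^ (j + d) * cnj (w l ^ k)) * cinner (B (y j)) (y k))"
    unfolding f_def bounded_clinear_sum [OF assms(3)] cinner_sum_left
    unfolding cinner_sum_right
    by (simp add: bounded_clinear_scaleC [OF assms(3)] cinner_scaleC_left cinner_scaleC_right
        sum_distrib_left power_add mult_ac)
  also have "\<dots> = (\<Sum>j\<le>N. \<Sum>l<M. \<Sum>k\<le>N. (w l ^ (j + d) * cnj (w l ^ k)) * cinner (B (y j)) (y k))"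
    by (rule sum.swap)
  also have "\<dots> = (\<Sum>j\<le>N. \<Sum>k\<le>N. \<Sum>l<M. (w l ^ (j + d) * cnj (w l ^ k)) * cinner (B (y j)) (y k))"
    by (intro sum.cong refl sum.swap)
  also have "\<dots> = (\<Sum>j\<le>N. \<Sum>k\<le>N. (if j + d = k then of_nat M else 0) * cinner (B (y j)) (y k))"
  proof (intro sum.cong refl)
    fix j k assume "j \<in> {..N}" "k \<in> {..N}"
    then have "(\<Sum>l<M. w l ^ (j + d) * cnj (w l ^ k)) = (if j + d = k then of_nat M else 0)"
      using assms(4) unfolding w_def by (intro sum_roots_of_unity_orthogonal) auto
    then show "(\<Sum>l<M. (w l ^ (j + d) * cnj (w l ^ k)) * cinner (B (y j)) (y k))
        = (if j + d = k then of_nat M else 0) * cinner (B (y j)) (y k)"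
      by (simp flip: sum_distrib_right)
  qed
  also have "\<dots> = of_nat M * (\<Sum>j\<le>N. \<Sum>k\<le>N. if j + d = k then cinner (B (y j)) (y k) else 0)"
    unfolding sum_distrib_left by (intro sum.cong refl) simp
  finally show ?thesis .
qed

text \<open>The off-diagonal sum on the left is an average of the numbers \<open>\<zeta> \<langle>B f(\<zeta>), f(\<zeta>)\<rangle>\<close>,
  while the right-hand side is, by the case \<open>B = id\<close> and \<open>d = 0\<close>, the average of
  \<open>r \<parallel>f(\<zeta>)\<parallel>\<^sup>2\<close> over the same roots of unity.\<close>

lemma numerical_range_bound_path:
  fixes B :: "'h::complex_inner \<Rightarrow> 'h" and y :: "nat \<Rightarrow> 'h"
  assumes B: "bounded_clinear B"
    and r: "\<And>x. cmod (cinner (B x) x) \<le> r * (norm x)\<^sup>2"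
  shows "cmod (\<Sum>j<N. cinner (B (y j)) (y (Suc j))) \<le> r * (\<Sum>j\<le>N. (norm (y j))\<^sup>2)"
proof -
  define M where "M = N + 2"
  define w where "w = (\<lambda>l. cis (2 * pi * real l / real M))"
  define f where "f = (\<lambda>l. \<Sum>j\<le>N. (w l ^ j) *\<^sub>C y j)"
  have id: "bounded_clinear (\<lambda>x::'h. x)"
    by (simp add: bounded_clinear_def bounded_linear_ident)
  have "(\<Sum>l<M. w l ^ 1 * cinner (B (f l)) (f l))
    = of_nat M * (\<Sum>j\<le>N. \<Sum>k\<le>N. if j + 1 = k then cinner (B (y j)) (y k) else 0)"
    unfolding f_def w_def by (rule fourier_coefficient_cinner [OF B]) (simp add: M_def)
  also have "(\<Sum>j\<le>N. \<Sum>k\<le>N. if j + 1 = k then cinner (B (y j)) (y k) else 0)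
    = (\<Sum>j<N. cinner (B (y j)) (y (Suc j)))"
    by (auto simp: Suc_le_eq intro!: sum.mono_neutral_cong_right split: if_splits)
  finally have off: "of_nat M * (\<Sum>j<N. cinner (B (y j)) (y (Suc j)))
      = (\<Sum>l<M. w l * cinner (B (f l)) (f l))" by simp
  have "(\<Sum>l<M. w l ^ 0 * cinner (f l) (f l))
    = of_nat M * (\<Sum>j\<le>N. \<Sum>k\<le>N. if j + 0 = k then cinner (y j) (y k) else 0)"
    unfolding f_def w_def by (rule fourier_coefficient_cinner [OF id]) (simp add: M_def)
  then have "complex_of_real (\<Sum>l<M. (norm (f l))\<^sup>2) = of_real (real M * (\<Sum>j\<le>N. (norm (y j))\<^sup>2))"
    by (simp add: cinner_self)
  then have diag: "(\<Sum>l<M. (norm (f l))\<^sup>2) = real M * (\<Sum>j\<le>N. (norm (y j))\<^sup>2)"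
    using of_real_eq_iff by blast
  have "real M * cmod (\<Sum>j<N. cinner (B (y j)) (y (Suc j)))
      = cmod (\<Sum>l<M. w l * cinner (B (f l)) (f l))"
    by (simp flip: off add: norm_mult del: of_nat_add)
  also have "\<dots> \<le> (\<Sum>l<M. cmod (cinner (B (f l)) (f l)))"
    by (rule order_trans [OF norm_sum]) (simp add: norm_mult w_def)
  also have "\<dots> \<le> (\<Sum>l<M. r * (norm (f l))\<^sup>2)"
    by (intro sum_mono r)
  also have "\<dots> = real M * (r * (\<Sum>j\<le>N. (norm (y j))\<^sup>2))"
    by (simp add: diag flip: sum_distrib_left)
  finally show ?thesis by (simp add: M_def)
qed

section \<open>A potential for the numerical radius\<close>

text \<open>Regard \<open>c(x, y) = r (\<parallel>x\<parallel>\<^sup>2 + \<parallel>y\<parallel>\<^sup>2) - 2 Re (u \<langle>B x, y\<rangle>)\<close> as the cost of a step from \<open>x\<close> to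
  \<open>y\<close>. The bound on paths says that a path from \<open>0\<close> to \<open>v\<close> costs at least \<open>- r \<parallel>v\<parallel>\<^sup>2\<close>, so
  the cheapest cost \<open>\<phi> v\<close> of reaching \<open>v\<close> from \<open>0\<close> is finite, and prolonging a path by
  one step gives \<open>\<phi> y \<le> \<phi> x + c(x, y)\<close>, the claim.\<close>

lemma numerical_range_potential:
  fixes B :: "'h::complex_inner \<Rightarrow> 'h" and u :: complex
  assumes B: "bounded_clinear B"
    and r: "\<And>x. cmod (cinner (B x) x) \<le> r * (norm x)\<^sup>2"
    and u: "cmod u = 1"
  obtains \<phi> :: "'h \<Rightarrow> real"
  where "\<And>x y. 2 * Re (u * cinner (B x) y) \<le> r * ((norm x)\<^sup>2 + (norm y)\<^sup>2) + \<phi> x - \<phi> y"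
proof -
  define c where "c = (\<lambda>x y. r * ((norm x)\<^sup>2 + (norm y)\<^sup>2) - 2 * Re (u * cinner (B x) y))"
  define C where "C = (\<lambda>v. {(\<Sum>j<N. c (y j) (y (Suc j))) | N y. y 0 = 0 \<and> y N = v})"
  have lower: "- r * (norm v)\<^sup>2 \<le> t" if "t \<in> C v" for v t
  proof -
    from that obtain N y where y: "y 0 = 0" "y N = v" "t = (\<Sum>j<N. c (y j) (y (Suc j)))"
      by (auto simp: C_def)
    define Q where "Q = Re (u * (\<Sum>j<N. cinner (B (y j)) (y (Suc j))))"
    have "Q \<le> r * (\<Sum>j\<le>N. (norm (y j))\<^sup>2)"
      unfolding Q_def using complex_Re_le_cmod [of "u * (\<Sum>j<N. cinner (B (y j)) (y (Suc j)))"]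
        numerical_range_bound_path [OF B r, where y = y and N = N] u by (simp add: norm_mult)
    moreover have "r * (\<Sum>j<N. (norm (y j))\<^sup>2) = r * (\<Sum>j\<le>N. (norm (y j))\<^sup>2) - r * (norm v)\<^sup>2"
      by (simp add: y(2) distrib_left flip: lessThan_Suc_atMost)
    moreover have "(\<Sum>j<N. (norm (y (Suc j)))\<^sup>2) = (\<Sum>j\<le>N. (norm (y j))\<^sup>2)"
      using sum.lessThan_Suc_shift [of "\<lambda>j. (norm (y j))\<^sup>2" N]
      by (simp add: y(1) lessThan_Suc_atMost)
    moreover have "t = r * ((\<Sum>j<N. (norm (y j))\<^sup>2) + (\<Sum>j<N. (norm (y (Suc j)))\<^sup>2))
        - 2 * Q"
      unfolding y(3) c_def Q_def
      by (simp only: sum_subtractf sum.distrib sum_distrib_left Re_sum distrib_left)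
    ultimately show ?thesis by (simp add: algebra_simps)
  qed
  have bdd: "bdd_below (C v)" for v
    using lower by (meson bdd_belowI)
  have step: "t + c x z \<in> C z" if t: "t \<in> C x" for t x z
  proof -
    from t obtain N y where y: "y 0 = 0" "y N = x" "t = (\<Sum>j<N. c (y j) (y (Suc j)))"
      by (auto simp: C_def)
    define y' where "y' = (\<lambda>j. if j \<le> N then y j else z)"
    have "(\<Sum>j<Suc N. c (y' j) (y' (Suc j))) = t + c x z"
      by (simp add: y'_def y)
    then show ?thesis
      unfolding C_def using y(1)
      by (intro CollectI exI [of _ "Suc N"] exI [of _ y']) (simp add: y'_def)
  qed
  have "(\<Sum>j<0. c ((\<lambda>_. 0) j) ((\<lambda>_. 0) (Suc j))) \<in> C 0"
    unfolding C_def by (intro CollectI exI [of _ 0] exI [of _ "\<lambda>_. 0"]) simp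
  then have ne: "C v \<noteq> {}" for v
    using step by blast
  show ?thesis
  proof (rule that [of "\<lambda>v. Inf (C v)"])
    fix x z
    have "Inf (C z) - c x z \<le> Inf (C x)"
    proof (rule cInf_greatest [OF ne])
      fix t assume "t \<in> C x"
      then have "Inf (C z) \<le> t + c x z" by (intro cInf_lower bdd step)
      then show "Inf (C z) - c x z \<le> t" by simp
    qed
    then show "2 * Re (u * cinner (B x) z) \<le> r * ((norm x)\<^sup>2 + (norm z)\<^sup>2) + Inf (C x) - Inf (C z)"
      by (simp add: c_def)
  qed
qed

text \<open>Summing the inequality for the potential with doubly stochastic weights, the potential
  contributes \<open>\<Sum>j. \<phi> x\<^sub>j\<close> through the column sums and \<open>- \<Sum>i. \<phi> x\<^sub>i\<close> through the row sums, and so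
  cancels.\<close>

lemma numerical_range_bound_doubly_stochastic:
  fixes B :: "'h::complex_inner \<Rightarrow> 'h" and s :: "'n::finite \<Rightarrow> 'n \<Rightarrow> real"
  assumes B: "bounded_clinear B"
    and r: "\<And>x. cmod (cinner (B x) x) \<le> r * (norm x)\<^sup>2"
    and s: "\<And>i j. 0 \<le> s i j" "\<And>i. (\<Sum>j\<in>UNIV. s i j) = 1" "\<And>j. (\<Sum>i\<in>UNIV. s i j) = 1"
  shows "cmod (\<Sum>i\<in>UNIV. \<Sum>j\<in>UNIV. of_real (s i j) * cinner (B (x j)) (x i))
    \<le> r * (\<Sum>i\<in>UNIV. (norm (x i))\<^sup>2)"
proof -
  let ?z = "\<Sum>i\<in>UNIV. \<Sum>j\<in>UNIV. of_real (s i j) * cinner (B (x j)) (x i)"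
  obtain u where u: "cmod u = 1" "Re (u * ?z) = cmod ?z"
    by (rule unimodular_rotation_to_norm)
  obtain \<phi> where \<phi>: "\<And>x y. 2 * Re (u * cinner (B x) y)
      \<le> r * ((norm x)\<^sup>2 + (norm y)\<^sup>2) + \<phi> x - \<phi> y"
    using numerical_range_potential [OF B r u(1)] by blast
  have rows: "(\<Sum>i\<in>UNIV. \<Sum>j\<in>UNIV. s i j * g i) = (\<Sum>i\<in>UNIV. g i)" for g
    by (simp add: s flip: sum_distrib_right)
  have cols: "(\<Sum>i\<in>UNIV. \<Sum>j\<in>UNIV. s i j * g j) = (\<Sum>i\<in>UNIV. g i)" for g
    by (subst sum.swap) (simp add: s flip: sum_distrib_right)
  have "2 * cmod ?z = (\<Sum>i\<in>UNIV. \<Sum>j\<in>UNIV. s i j * (2 * Re (u * cinner (B (x j)) (x i))))"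
  proof -
    have Re_of_real_mult: "Re (of_real a * z) = a * Re z" for a z
      by simp
    have "u * ?z = (\<Sum>i\<in>UNIV. \<Sum>j\<in>UNIV. of_real (s i j) * (u * cinner (B (x j)) (x i)))"
      by (simp add: sum_distrib_left mult_ac)
    then have "Re (u * ?z) = (\<Sum>i\<in>UNIV. \<Sum>j\<in>UNIV. s i j * Re (u * cinner (B (x j)) (x i)))"
      by (simp only: Re_sum Re_of_real_mult)
    then show ?thesis
      unfolding u(2) by (simp only: sum_distrib_left mult.left_commute)
  qed
  also have "\<dots> \<le> (\<Sum>i\<in>UNIV. \<Sum>j\<in>UNIV.
      s i j * (r * ((norm (x j))\<^sup>2 + (norm (x i))\<^sup>2) + \<phi> (x j) - \<phi> (x i)))"
    by (intro sum_mono mult_left_mono \<phi> s)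
  also have "\<dots> = (\<Sum>i\<in>UNIV. \<Sum>j\<in>UNIV. s i j * (r * (norm (x j))\<^sup>2 + \<phi> (x j)))
      + (\<Sum>i\<in>UNIV. \<Sum>j\<in>UNIV. s i j * (r * (norm (x i))\<^sup>2 - \<phi> (x i)))"
    by (simp add: algebra_simps flip: sum.distrib)
  also have "\<dots> = 2 * (r * (\<Sum>i\<in>UNIV. (norm (x i))\<^sup>2))"
    unfolding rows cols by (simp add: sum.distrib sum_subtractf sum_distrib_left)
  finally show ?thesis by simp
qed

section \<open>Doubly stochastic averages and the lp norms\<close>

lemma convex_on_powr_nonneg:
  assumes "1 \<le> (q::real)"
  shows "convex_on {0..} (\<lambda>t. t powr q)"
proof (rule convex_onI)
  fix t x y :: real
  assume t: "0 < t" "t < 1" and xy: "x \<in> {0..}" "y \<in> {0..}"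
  have shrink: "(a * z) powr q \<le> a * z powr q" if "0 < a" "a \<le> 1" "0 \<le> z" for a z :: real
  proof -
    have "a powr q \<le> a powr 1" using that assms by (intro powr_mono') auto
    then show ?thesis using that by (simp add: powr_mult mult_right_mono)
  qed
  show "((1 - t) *\<^sub>R x + t *\<^sub>R y) powr q \<le> (1 - t) * x powr q + t * y powr q"
  proof (cases "x = 0 \<or> y = 0")
    case True
    then show ?thesis using shrink [of t y] shrink [of "1 - t" x] t xy by auto
  next
    case False
    then show ?thesis
      using xy t convex_onD [OF powr_convex [OF assms], of t x y] by auto
  qed
qed simp

text \<open>By convexity of \<open>t \<mapsto> t^q\<close>, the \<open>q\<close>-th power of a row average is at most the same row
  average of \<open>q\<close>-th powers; summing over the rows uses up the column sums.\<close>

lemma sum_powr_doubly_stochastic_le: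
  fixes s :: "'n::finite \<Rightarrow> 'n \<Rightarrow> real"
  assumes s: "\<And>i j. 0 \<le> s i j" "\<And>i. (\<Sum>j\<in>UNIV. s i j) = 1" "\<And>j. (\<Sum>i\<in>UNIV. s i j) = 1"
    and t: "\<And>j. 0 \<le> t j" and q: "1 \<le> q"
  shows "(\<Sum>i\<in>UNIV. (\<Sum>j\<in>UNIV. s i j * t j) powr q) \<le> (\<Sum>j\<in>UNIV. t j powr q)"
proof -
  have "(\<Sum>i\<in>UNIV. (\<Sum>j\<in>UNIV. s i j * t j) powr q) \<le> (\<Sum>i\<in>UNIV. \<Sum>j\<in>UNIV. s i j * t j powr q)"
  proof (rule sum_mono)
    fix i
    show "(\<Sum>j\<in>UNIV. s i j * t j) powr q \<le> (\<Sum>j\<in>UNIV. s i j * t j powr q)"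
      using convex_on_sum [OF finite_class.finite_UNIV UNIV_not_empty convex_on_powr_nonneg [OF q], of "s i" t]
        s t by simp
  qed
  also have "\<dots> = (\<Sum>j\<in>UNIV. t j powr q)"
    by (subst sum.swap) (simp add: s flip: sum_distrib_right)
  finally show ?thesis .
qed

lemma ereal_ge_1_cases:
  assumes "1 \<le> p"
  obtains "p = \<infinity>" | q where "p = ereal q" "1 \<le> q"
  using assms by (cases p) auto

lemma lp_norm_nonneg: "0 \<le> lp_norm p x"
proof (cases "p = \<infinity>")
  case True
  have "0 \<le> norm (x $ undefined)" by simp
  also have "\<dots> \<le> Max (range (\<lambda>j. norm (x $ j)))" by (intro Max_ge) auto
  finally show ?thesis using True by (simp add: lp_norm_def)
qed (simp add: lp_norm_def)

lemma lp_norm_doubly_stochastic_le: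
  fixes s :: "'n::finite \<Rightarrow> 'n \<Rightarrow> real"
    and x :: "'a::real_normed_vector ^ 'n" and y :: "'b::real_normed_vector ^ 'n"
  assumes s: "\<And>i j. 0 \<le> s i j" "\<And>i. (\<Sum>j\<in>UNIV. s i j) = 1" "\<And>j. (\<Sum>i\<in>UNIV. s i j) = 1"
    and K: "0 \<le> K" and y: "\<And>i. norm (y $ i) \<le> K * (\<Sum>j\<in>UNIV. s i j * norm (x $ j))"
    and p: "1 \<le> p"
  shows "lp_norm p y \<le> K * lp_norm p x"
  using p
proof (cases rule: ereal_ge_1_cases)
  case 1
  define m where "m = Max (range (\<lambda>j. norm (x $ j)))"
  have "norm (y $ i) \<le> K * m" for i
  proof -
    have "(\<Sum>j\<in>UNIV. s i j * norm (x $ j)) \<le> (\<Sum>j\<in>UNIV. s i j * m)"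
      by (intro sum_mono mult_left_mono s) (simp add: m_def)
    also have "\<dots> = m" by (simp add: s flip: sum_distrib_right)
    finally show ?thesis using y [of i] K by (meson mult_left_mono order_trans)
  qed
  then show ?thesis using 1 by (simp add: lp_norm_def m_def)
next
  case (2 q)
  have "(\<Sum>i\<in>UNIV. norm (y $ i) powr q)
      \<le> (\<Sum>i\<in>UNIV. (K * (\<Sum>j\<in>UNIV. s i j * norm (x $ j))) powr q)"
    using 2 y by (intro sum_mono powr_mono2) auto
  also have "\<dots> = K powr q * (\<Sum>i\<in>UNIV. (\<Sum>j\<in>UNIV. s i j * norm (x $ j)) powr q)"
    using K s unfolding sum_distrib_left [of "K powr q"]
    by (intro sum.cong refl) (simp add: powr_mult sum_nonneg)
  also have "\<dots> \<le> K powr q * (\<Sum>j\<in>UNIV. norm (x $ j) powr q)"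
    by (intro mult_left_mono sum_powr_doubly_stochastic_le s 2) auto
  finally have "(\<Sum>i\<in>UNIV. norm (y $ i) powr q) powr (1 / q)
      \<le> (K powr q * (\<Sum>j\<in>UNIV. norm (x $ j) powr q)) powr (1 / q)"
    using 2 by (intro powr_mono2) (auto simp: sum_nonneg)
  also have "\<dots> = K * (\<Sum>j\<in>UNIV. norm (x $ j) powr q) powr (1 / q)"
    using 2 K by (simp add: powr_mult sum_nonneg powr_powr)
  finally show ?thesis using 2 by (simp add: lp_norm_def)
qed

lemma lp_norm_constant:
  assumes "1 \<le> p"
  obtains C where "0 < C"
    "\<And>v::'a::real_normed_vector. lp_norm p ((\<chi> i. v) :: 'a ^ 'n::finite) = C * norm v"
  using assms
proof (cases rule: ereal_ge_1_cases)
  case 1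
  then show ?thesis by (intro that [of 1]) (simp_all add: lp_norm_def)
next
  case (2 q)
  then show ?thesis
    by (intro that [of "real CARD('n) powr (1 / q)"])
      (simp_all add: lp_norm_def powr_mult powr_powr)
qed

section \<open>Multiples of doubly stochastic matrices\<close>

text \<open>Both values are attained in the limit on constant vectors \<open>(v, \<dots>, v)\<close>, which the operator
  matrix maps to \<open>(k B v, \<dots>, k B v)\<close> because the rows of \<open>A\<close> sum to \<open>k\<close>.\<close>

theorem corollary1p8:
  fixes B :: "'h::complex_hilbert_space \<Rightarrow> 'h"
    and A :: "complex ^ 'n ^ 'n"
    and k :: real
  assumes "\<exists>x::'h. x \<noteq> 0"
    and "bounded_clinear B"
    and "\<forall>i j. A $ i $ j \<in> \<real>\<^sub>\<ge>\<^sub>0"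
    and "0 \<le> k"
    and "\<exists>S. doubly_stochastic S \<and> A = k *\<^sub>R S"
  shows "(\<forall>p::ereal. 1 \<le> p \<longrightarrow> op_lp_norm p (A \<otimes>\<^sub>K B) = k * onorm B) \<and>
    numerical_radius (A \<otimes>\<^sub>K B) = k * numerical_radius B"
proof -
  note B = assms(2) and k = assms(4)
  have bl: "bounded_linear B" using B by (simp add: bounded_clinear_def)
  obtain S where S: "doubly_stochastic S" "A = k *\<^sub>R S" using assms(5) by blast
  define s where "s = (\<lambda>i j. Re (S $ i $ j))"
  have S_eq: "S $ i $ j = of_real (s i j)" and s_nonneg: "0 \<le> s i j" for i j
    using S(1) by (auto simp: doubly_stochastic_def s_def complex_nonneg_Reals_iff complex_eq_iff)
  have rows: "(\<Sum>j\<in>UNIV. s i j) = 1" and cols: "(\<Sum>j\<in>UNIV. s j i) = 1" for i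
    using S(1) by (simp_all add: doubly_stochastic_def s_def flip: Re_sum)
  note s = s_nonneg rows cols
  have A_eq: "A $ i $ j = of_real (k * s i j)" for i j
    by (simp only: S(2) vector_scaleR_component S_eq) (simp add: scaleR_conv_of_real)
  have entry: "(A \<otimes>\<^sub>K B) x $ i = (\<Sum>j\<in>UNIV. (k * s i j) *\<^sub>R B (x $ j))" for x i
    by (simp add: kronecker_def A_eq scaleR_scaleC)
  have const: "(A \<otimes>\<^sub>K B) (\<chi> i. v) = (\<chi> i. k *\<^sub>R B v)" for v
    by (simp add: vec_eq_iff entry rows flip: scaleR_left.sum sum_distrib_left)
  obtain e :: 'h where e: "e \<noteq> 0" using assms(1) by blast

  have "op_lp_norm p (A \<otimes>\<^sub>K B) = k * onorm B" if p: "1 \<le> p" for p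
  proof (rule antisym)
    have ratio: "lp_norm p ((A \<otimes>\<^sub>K B) x) / lp_norm p x \<le> k * onorm B" for x
    proof -
      have "lp_norm p ((A \<otimes>\<^sub>K B) x) \<le> k * onorm B * lp_norm p x"
      proof (rule lp_norm_doubly_stochastic_le [OF s _ _ p])
        show "0 \<le> k * onorm B" using k onorm_pos_le [OF bl] by simp
        fix i
        have "norm ((A \<otimes>\<^sub>K B) x $ i) \<le> (\<Sum>j\<in>UNIV. (k * s i j) * norm (B (x $ j)))"
          unfolding entry by (rule order_trans [OF norm_sum]) (simp add: k s)
        also have "\<dots> \<le> (\<Sum>j\<in>UNIV. (k * s i j) * (onorm B * norm (x $ j)))"
          by (intro sum_mono mult_left_mono onorm [OF bl]) (simp add: k s)
        also have "\<dots> = k * onorm B * (\<Sum>j\<in>UNIV. s i j * norm (x $ j))"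
          by (simp add: sum_distrib_left mult_ac)
        finally show "norm ((A \<otimes>\<^sub>K B) x $ i) \<le> k * onorm B * (\<Sum>j\<in>UNIV. s i j * norm (x $ j))" .
      qed
      moreover have "0 \<le> lp_norm p x" by (rule lp_norm_nonneg)
      ultimately show ?thesis
        using k onorm_pos_le [OF bl]
        by (cases "lp_norm p x = 0") (simp_all add: divide_le_eq)
    qed
    have nonzero: "(\<chi> i. v) \<in> {x :: 'h ^ 'n. x \<noteq> 0}" if "v \<noteq> 0" for v
      using that by (simp add: vec_eq_iff)
    show "op_lp_norm p (A \<otimes>\<^sub>K B) \<le> k * onorm B"
      unfolding op_lp_norm_def using nonzero [OF e] by (intro cSUP_least ratio) blast
    have upper: "lp_norm p ((A \<otimes>\<^sub>K B) x) / lp_norm p x \<le> op_lp_norm p (A \<otimes>\<^sub>K B)"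
      if "x \<in> {x. x \<noteq> 0}" for x
      unfolding op_lp_norm_def using that ratio by (intro cSUP_upper bdd_aboveI2) auto
    obtain C where C: "0 < C" "\<And>v::'h. lp_norm p ((\<chi> i. v) :: 'h ^ 'n) = C * norm v"
      using lp_norm_constant [OF p] by blast
    have le: "k * (norm (B v) / norm v) \<le> op_lp_norm p (A \<otimes>\<^sub>K B)" if "v \<noteq> 0" for v
      using upper [OF nonzero [OF that]] C(1) k by (simp add: const C(2))
    then have nonneg: "0 \<le> op_lp_norm p (A \<otimes>\<^sub>K B)"
      using k by (intro order_trans [OF _ le [OF e]]) simp
    show "k * onorm B \<le> op_lp_norm p (A \<otimes>\<^sub>K B)"
      unfolding onorm_def
    proof (rule mult_cSUP_le [OF UNIV_not_empty k nonneg])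
      show "k * (norm (B v) / norm v) \<le> op_lp_norm p (A \<otimes>\<^sub>K B)" for v
        using le [of v] nonneg by (cases "v = 0") simp_all
    qed
  qed
  moreover have "numerical_radius (A \<otimes>\<^sub>K B) = k * numerical_radius B"
  proof (rule antisym)
    have quad: "cmod (cinner ((A \<otimes>\<^sub>K B) x) x) \<le> k * numerical_radius B * (norm x)\<^sup>2" for x
    proof -
      have "cinner ((A \<otimes>\<^sub>K B) x) x
          = of_real k * (\<Sum>i\<in>UNIV. \<Sum>j\<in>UNIV. of_real (s i j) * cinner (B (x $ j)) (x $ i))"
        by (simp add: cinner_vec_def entry scaleR_scaleC cinner_sum_left cinner_scaleC_left
            sum_distrib_left mult_ac)
      moreover have "cmod (\<Sum>i\<in>UNIV. \<Sum>j\<in>UNIV. of_real (s i j) * cinner (B (x $ j)) (x $ i))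
          \<le> numerical_radius B * (norm x)\<^sup>2"
        unfolding norm_vec_power2
        by (intro numerical_range_bound_doubly_stochastic B s cmod_cinner_le_numerical_radius)
      ultimately show ?thesis using k by (simp add: norm_mult mult_left_mono mult.assoc)
    qed
    \<comment> \<open>the factor makes the constant vector of a unit vector a unit vector\<close>
    define n where "n = real CARD('n)"
    have n: "n > 0" by (simp add: n_def)
    define E where "E = (\<lambda>v::'h. (\<chi> i. (1 / sqrt n) *\<^sub>R v) :: 'h ^ 'n)"
    have E: "E v \<in> {x. norm x = 1}" if "norm v = 1" for v
    proof -
      have "(norm (E v))\<^sup>2 = 1"
        using n that by (simp add: norm_vec_power2 E_def power_divide n_def)
      then show ?thesis by (simp add: power2_eq_1_iff) (use norm_ge_zero [of "E v"] in linarith)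
    qed
    have cinner_E: "cinner ((A \<otimes>\<^sub>K B) (E v)) (E v) = of_real k * cinner (B v) v" for v
      using n by (simp add: E_def const cinner_vec_def scaleR_scaleC cinner_scaleC_left
          cinner_scaleC_right bounded_clinear_scaleC [OF B] n_def flip: of_real_mult)
    have unit: "(1 / norm e) *\<^sub>R e \<in> {x. norm x = 1}" using e by simp
    show "numerical_radius (A \<otimes>\<^sub>K B) \<le> k * numerical_radius B"
      unfolding numerical_radius_def [of "A \<otimes>\<^sub>K B"]
    proof (rule cSUP_least)
      show "{x::'h ^ 'n. norm x = 1} \<noteq> {}" using E unit by blast
      show "cmod (cinner ((A \<otimes>\<^sub>K B) x) x) \<le> k * numerical_radius B" if "x \<in> {x. norm x = 1}" for x
        using quad [of x] that by simp
    qed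
    have le: "k * cmod (cinner (B v) v) \<le> numerical_radius (A \<otimes>\<^sub>K B)" if "v \<in> {v. norm v = 1}" for v
    proof -
      have "bdd_above ((\<lambda>x. cmod (cinner ((A \<otimes>\<^sub>K B) x) x)) ` {x. norm x = 1})"
      proof (rule bdd_aboveI2)
        fix x :: "'h ^ 'n" assume "x \<in> {x. norm x = 1}"
        then show "cmod (cinner ((A \<otimes>\<^sub>K B) x) x) \<le> k * numerical_radius B"
          using quad [of x] by simp
      qed
      then have "cmod (cinner ((A \<otimes>\<^sub>K B) (E v)) (E v)) \<le> numerical_radius (A \<otimes>\<^sub>K B)"
        unfolding numerical_radius_def using E that by (intro cSUP_upper) auto
      then show ?thesis using k by (simp add: cinner_E norm_mult)
    qed
    show "k * numerical_radius B \<le> numerical_radius (A \<otimes>\<^sub>K B)"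
      unfolding numerical_radius_def [of B]
    proof (rule mult_cSUP_le [OF _ k _ le])
      show "{v::'h. norm v = 1} \<noteq> {}" using unit by blast
      show "0 \<le> numerical_radius (A \<otimes>\<^sub>K B)"
        using k by (intro order_trans [OF _ le [OF unit]]) simp
    qed
  qed
  ultimately show ?thesis by blast
qed

end
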